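(* Let $f(x)=\sum_{i=1}^m f_i(x_{\Delta_i})$ be a real polynomial in $x=(x_1,\dots,x_n)$, where $\Delta_i\subset\{1,\dots,n\}$, each $f_i\in\mathbb{R}[x_{\Delta_i}]$ has even degree $2d_i$, and $\deg f=2d=\max_i2d_i$. Then the optimal values $f^*_{\Sigma_s}$, $f^*_{\Delta_s}$ (sparser moment and SOS relaxations), $f^*_\Sigma$, $f^*_\Delta$ (sparse moment and SOS relaxations), $f^*_{sos}$ (standard SOS relaxation) and $f^*$ (global minimum value), as defined in the context, satisfy $$f^*_{\Sigma_s}=f^*_{\Delta_s}\le f^*_\Sigma=f^*_\Delta\le f^*_{sos}\le f^*.$$
   Context: Notation: for $\Delta_i\subset\{1,\dots,n\}$, $x_{\Delta_i}=(x_j)_{j\in\Delta_i}$. For $\alpha\in\mathbb{N}^n$ (with $0\in\mathbb{N}$), $|\alpha|=\sum_j\alpha_j$, $\mathrm{supp}(\alpha)=\{j:\alpha_j\ne0\}$; for a polynomial $p$, $\mathrm{supp}(p)$ is the set of exponents $\alpha\in\mathbb{N}^n$ of monomials with nonzero coefficient in $p$. Write $f=\sum_\alpha f_\alpha x^\alpha$. $\mathbf{m}_d(x_{\Delta_i})$ is the column vector of all monomials in $x_{\Delta_i}$ of degree at most $d$. Optimal values are suprema/infima in $[-\infty,+\infty]$. Values: - $f^*=\inf_{x\in\mathbb{R}^n}f(x)$; $f^*_{sos}=\sup\{\gamma: f(x)-\gamma\text{ is a sum of squares of real polynomials}\}$. - $f^*_\Delta=\sup\{\gamma: f(x)-\gamma=\sum_{i=1}^m\mathbf{m}_d(x_{\Delta_i})^TW_i\,\mathbf{m}_d(x_{\Delta_i})$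 identically for some real symmetric $W_i\succeq0\}$. - Let $\mathcal{F}=\bigcup_{i=1}^m\{\alpha\in\mathbb{N}^n:\mathrm{supp}(\alpha)\subset\Delta_i,|\alpha|\le2d\}$. For $y=(y_\alpha)_{\alpha\in\mathcal{F}}$ let $\mathcal{M}_d^{\Delta_i}(y)$ be the matrix indexed by $\{\alpha:\mathrm{supp}(\alpha)\subset\Delta_i,|\alpha|\le d\}$ with entries $y_{\alpha+\beta}$. $f^*_\Sigma=\inf\{\sum_{\alpha\in\mathcal{F}}f_\alpha y_\alpha: \mathcal{M}_d^{\Delta_i}(y)\succeq0\ (i=1,\dots,m),\ y_0=1\}$. - Let $\mathcal{G}_i$ be the set of points of $\mathbb{N}^n$ in the convex hull of $\{\alpha\in\mathbb{N}^n:2\alpha\in\mathrm{supp}(f_i)\}$, and $\mathbf{m}_{\mathcal{G}_i}(x)$ the column vector of monomials $x^\alpha$, $\alpha\in\mathcal{G}_i$. $f^*_{\Delta_s}=\sup\{\gamma: f(x)-\gamma=\sum_{i=1}^m\mathbf{m}_{\mathcal{G}_i}(x)^TW_i\,\mathbf{m}_{\mathcal{G}_i}(x)$ identically for some real symmetric $W_i\succeq0$ (of size $|\mathcal{G}_i|$)$\}$. - For $y$ indexed by $\{0\}\cup\mathrm{supp}(f)\cup\bigcup_i(\mathcal{G}_i+\mathcal{G}_i)$, let $\mathcal{M}_{\mathcal{G}_i}(y)$ be the matrix indexed by $\mathcal{G}_i$ with entries $\mathcal{M}_{\mathcal{G}_i}(y)(\alpha,\beta)=y_{\alpha+\beta}$.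 $f^*_{\Sigma_s}=\inf\{\sum_\alpha f_\alpha y_\alpha:\mathcal{M}_{\mathcal{G}_i}(y)\succeq0\ (i=1,\dots,m),\ y_0=1\}$. *)

theory Defs
  imports "HOL-Analysis.Analysis" "HOL-Library.Poly_Mapping"
begin

text \<open>
  The variables are indexed by a finite type \<open>'n\<close>, so \<open>n = CARD('n)\<close>; exponents are elements of
  \<open>nat ^ 'n\<close>, and a real polynomial is its finitely supported family of coefficients, with the
  convolution product of \<^theory>\<open>HOL-Library.Poly_Mapping\<close>.
\<close>

type_synonym 'n expo = "nat ^ 'n"
type_synonym 'n rpoly = "(nat ^ 'n) \<Rightarrow>\<^sub>0 real"

abbreviation coeff :: "'n::finite rpoly \<Rightarrow> 'n expo \<Rightarrow> real" where
  "coeff \<equiv> Poly_Mapping.lookup"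

abbreviation supp :: "'n::finite rpoly \<Rightarrow> 'n expo set" where
  "supp \<equiv> Poly_Mapping.keys"

definition Const :: "real \<Rightarrow> 'n::finite rpoly" where
  "Const c = Poly_Mapping.single 0 c"

definition Monom :: "'n::finite expo \<Rightarrow> 'n rpoly" where
  "Monom \<alpha> = Poly_Mapping.single \<alpha> 1"

definition eval_poly :: "'n::finite rpoly \<Rightarrow> real ^ 'n \<Rightarrow> real" where
  "eval_poly p x = (\<Sum>\<alpha>\<in>supp p. coeff p \<alpha> * (\<Prod>j\<in>UNIV. (x $ j) ^ (\<alpha> $ j)))"

definition expo_supp :: "'n::finite expo \<Rightarrow> 'n set" where
  "expo_supp \<alpha> = {j. \<alpha> $ j \<noteq> 0}"

definition expo_deg :: "'n::finite expo \<Rightarrow> nat" where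
  "expo_deg \<alpha> = (\<Sum>j\<in>UNIV. \<alpha> $ j)"

text \<open>The zero polynomial is given degree 0.\<close>

definition total_deg :: "'n::finite rpoly \<Rightarrow> nat" where
  "total_deg p = Max (insert 0 (expo_deg ` supp p))"

definition poly_in :: "'n::finite set \<Rightarrow> 'n rpoly \<Rightarrow> bool" where
  "poly_in \<Delta> p \<longleftrightarrow> (\<forall>\<alpha>\<in>supp p. expo_supp \<alpha> \<subseteq> \<Delta>)"

definition expos :: "'n::finite set \<Rightarrow> nat \<Rightarrow> 'n expo set" where
  "expos \<Delta> k = {\<alpha>. expo_supp \<alpha> \<subseteq> \<Delta> \<and> expo_deg \<alpha> \<le> k}"

text \<open>
  A matrix with rows and columns indexed by a finite set \<open>S\<close> is a function of two arguments, of
  which only the values on \<open>S \<times> S\<close> matter.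
\<close>

definition psd_on :: "'a set \<Rightarrow> ('a \<Rightarrow> 'a \<Rightarrow> real) \<Rightarrow> bool" where
  "psd_on S W \<longleftrightarrow> (\<forall>\<alpha>\<in>S. \<forall>\<beta>\<in>S. W \<alpha> \<beta> = W \<beta> \<alpha>) \<and>
     (\<forall>v. 0 \<le> (\<Sum>\<alpha>\<in>S. \<Sum>\<beta>\<in>S. v \<alpha> * W \<alpha> \<beta> * v \<beta>))"

text \<open>\<open>m\<^sub>S(x)\<^sup>T W m\<^sub>S(x)\<close>, where \<open>m\<^sub>S\<close> is the vector of the monomials with exponent in \<open>S\<close>.\<close>

definition gram_poly :: "'n::finite expo set \<Rightarrow> ('n expo \<Rightarrow> 'n expo \<Rightarrow> real) \<Rightarrow> 'n rpoly" where
  "gram_poly S W = (\<Sum>\<alpha>\<in>S. \<Sum>\<beta>\<in>S. Monom \<alpha> * Const (W \<alpha> \<beta>) * Monom \<beta>)"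

definition moment_matrix :: "('n::finite expo \<Rightarrow> real) \<Rightarrow> 'n expo \<Rightarrow> 'n expo \<Rightarrow> real" where
  "moment_matrix y \<alpha> \<beta> = y (\<alpha> + \<beta>)"

definition is_sos :: "'n::finite rpoly \<Rightarrow> bool" where
  "is_sos p \<longleftrightarrow> (\<exists>qs :: 'n rpoly list. p = (\<Sum>q\<leftarrow>qs. q ^ 2))"

definition real_expo :: "'n::finite expo \<Rightarrow> real ^ 'n" where
  "real_expo \<alpha> = (\<chi> j. real (\<alpha> $ j))"

definition half_newton :: "'n::finite rpoly \<Rightarrow> 'n expo set" where
  "half_newton p = {\<alpha>. real_expo \<alpha> \<in> convex hull (real_expo ` {\<beta>. 2 *s \<beta> \<in> supp p})}"

text \<open>
  The optimal values lie in \<^typ>\<open>ereal\<close>: an infeasible supremum is \<open>-\<infinity>\<close>, an infeasible infimum \<open>\<infinity>\<close>.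
\<close>

definition f_min :: "'n::finite rpoly \<Rightarrow> ereal" where
  "f_min f = (INF x. ereal (eval_poly f x))"

definition f_sos :: "'n::finite rpoly \<Rightarrow> ereal" where
  "f_sos f = (SUP \<gamma>\<in>{\<gamma>. is_sos (f - Const \<gamma>)}. ereal \<gamma>)"

definition f_Delta :: "nat \<Rightarrow> (nat \<Rightarrow> 'n::finite set) \<Rightarrow> nat \<Rightarrow> 'n rpoly \<Rightarrow> ereal" where
  "f_Delta m \<Delta> d f =
     (SUP \<gamma>\<in>{\<gamma>. \<exists>W. (\<forall>i\<in>{1..m}. psd_on (expos (\<Delta> i) d) (W i)) \<and>
                    f - Const \<gamma> = (\<Sum>i=1..m. gram_poly (expos (\<Delta> i) d) (W i))}. ereal \<gamma>)"

text \<open>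
  In the moment problems \<open>y\<close> is a total function; objective and constraints depend only on its
  values on the index set (\<open>moment_index\<close>, respectively \<open>sparser_index\<close>).
\<close>

definition moment_index :: "nat \<Rightarrow> (nat \<Rightarrow> 'n::finite set) \<Rightarrow> nat \<Rightarrow> 'n expo set" where
  "moment_index m \<Delta> d = (\<Union>i\<in>{1..m}. expos (\<Delta> i) (2 * d))"

definition f_Sigma :: "nat \<Rightarrow> (nat \<Rightarrow> 'n::finite set) \<Rightarrow> nat \<Rightarrow> 'n rpoly \<Rightarrow> ereal" where
  "f_Sigma m \<Delta> d f =
     (INF y\<in>{y. (\<forall>i\<in>{1..m}. psd_on (expos (\<Delta> i) d) (moment_matrix y)) \<and> y 0 = 1}.
        ereal (\<Sum>\<alpha>\<in>moment_index m \<Delta> d. coeff f \<alpha> * y \<alpha>))"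

text \<open>In the sparser relaxations \<open>f\<close> is the sum of the given family \<open>fs 1, \<dots>, fs m\<close>.\<close>

definition f_Delta_s :: "nat \<Rightarrow> (nat \<Rightarrow> 'n::finite rpoly) \<Rightarrow> 'n rpoly \<Rightarrow> ereal" where
  "f_Delta_s m fs f =
     (SUP \<gamma>\<in>{\<gamma>. \<exists>W. (\<forall>i\<in>{1..m}. psd_on (half_newton (fs i)) (W i)) \<and>
                    f - Const \<gamma> = (\<Sum>i=1..m. gram_poly (half_newton (fs i)) (W i))}. ereal \<gamma>)"

definition sparser_index :: "nat \<Rightarrow> (nat \<Rightarrow> 'n::finite rpoly) \<Rightarrow> 'n rpoly \<Rightarrow> 'n expo set" where
  "sparser_index m fs f =
     {0} \<union> supp f \<union> (\<Union>i\<in>{1..m}. {\<alpha> + \<beta> | \<alpha> \<beta>. \<alpha> \<in> half_newton (fs i) \<and> \<beta> \<in> half_newton (fs i)})"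

definition f_Sigma_s :: "nat \<Rightarrow> (nat \<Rightarrow> 'n::finite rpoly) \<Rightarrow> 'n rpoly \<Rightarrow> ereal" where
  "f_Sigma_s m fs f =
     (INF y\<in>{y. (\<forall>i\<in>{1..m}. psd_on (half_newton (fs i)) (moment_matrix y)) \<and> y 0 = 1}.
        ereal (\<Sum>\<alpha>\<in>sparser_index m fs f. coeff f \<alpha> * y \<alpha>))"

end

theory Submission
  imports Defs
begin

text \<open>
  Each pair of a moment and an SOS relaxation is a conic dual pair over the cone of all polynomials
  \<open>\<Sum>\<^sub>i m\<^sub>S\<^sub>i\<^sup>T W\<^sub>i m\<^sub>S\<^sub>i\<close> with \<open>W\<^sub>i \<succeq> 0\<close>. The functional with moments \<open>M ^ |\<alpha>|\<^sup>2\<close> dominates the traces of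
  the \<open>W\<^sub>i\<close>, so a polynomial outside the cone has a nearest point in it, and the residual gives a
  separating functional. Adding a large multiple of this functional to evaluation at the origin and
  renormalising the mass shows that there is no duality gap. The inequalities between the
  relaxations are inclusions of the cones, since half the Newton polytope of \<open>f\<^sub>i\<close> contains only
  exponents supported in \<open>\<Delta>\<^sub>i\<close> of degree at most \<open>d\<close>.
\<close>

section \<open>Positive semidefinite matrices\<close>

lemma psd_onD_sym: "psd_on S W \<Longrightarrow> \<alpha> \<in> S \<Longrightarrow> \<beta> \<in> S \<Longrightarrow> W \<alpha> \<beta> = W \<beta> \<alpha>"
  by (auto simp: psd_on_def)

lemma psd_onD_nonneg: "psd_on S W \<Longrightarrow> 0 \<le> (\<Sum>\<alpha>\<in>S. \<Sum>\<beta>\<in>S. v \<alpha> * W \<alpha> \<beta> * v \<beta>)"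
  by (auto simp: psd_on_def)

lemma psd_on_subset:
  assumes "psd_on T W" "S \<subseteq> T" "finite T"
  shows "psd_on S W"
  unfolding psd_on_def
proof (intro conjI ballI allI)
  show "W \<alpha> \<beta> = W \<beta> \<alpha>" if "\<alpha> \<in> S" "\<beta> \<in> S" for \<alpha> \<beta>
    using assms that by (auto intro: psd_onD_sym)
  fix v :: "'a \<Rightarrow> real"
  define u where "u \<alpha> = (if \<alpha> \<in> S then v \<alpha> else 0)" for \<alpha>
  have "(\<Sum>\<alpha>\<in>S. \<Sum>\<beta>\<in>S. v \<alpha> * W \<alpha> \<beta> * v \<beta>) = (\<Sum>\<alpha>\<in>S. \<Sum>\<beta>\<in>T. u \<alpha> * W \<alpha> \<beta> * u \<beta>)"
    using assms by (intro sum.cong refl sum.mono_neutral_cong_left) (auto simp: u_def)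
  also have "\<dots> = (\<Sum>\<alpha>\<in>T. \<Sum>\<beta>\<in>T. u \<alpha> * W \<alpha> \<beta> * u \<beta>)"
    using assms by (intro sum.mono_neutral_left) (auto simp: u_def)
  finally show "0 \<le> (\<Sum>\<alpha>\<in>S. \<Sum>\<beta>\<in>S. v \<alpha> * W \<alpha> \<beta> * v \<beta>)"
    using psd_onD_nonneg[OF assms(1)] by simp
qed

text \<open>Varying only the coordinate at \<open>a\<close> turns the quadratic form into a
  polynomial of degree at most two in \<open>t\<close>. Its discriminant yields both Cauchy-Schwarz
  and positivity of the Schur complement.\<close>

lemma psd_on_insert_quadratic:
  assumes "psd_on (insert a S) W" "finite S" "a \<notin> S"
  shows "0 \<le> t\<^sup>2 * W a a + 2 * t * (\<Sum>\<beta>\<in>S. W a \<beta> * v \<beta>) + (\<Sum>\<alpha>\<in>S. \<Sum>\<beta>\<in>S. v \<alpha> * W \<alpha> \<beta> * v \<beta>)"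
proof -
  define u where "u = v(a := t)"
  have uS: "u \<beta> = v \<beta>" if "\<beta> \<in> S" for \<beta> using that assms(3) by (auto simp: u_def)
  have ua: "u a = t" by (simp add: u_def)
  have "(\<Sum>\<alpha>\<in>insert a S. \<Sum>\<beta>\<in>insert a S. u \<alpha> * W \<alpha> \<beta> * u \<beta>)
      = t * W a a * t + (\<Sum>\<beta>\<in>S. t * W a \<beta> * v \<beta>)
        + (\<Sum>\<alpha>\<in>S. v \<alpha> * W \<alpha> a * t + (\<Sum>\<beta>\<in>S. v \<alpha> * W \<alpha> \<beta> * v \<beta>))"
    using assms(2,3) by (simp add: uS ua)
  also have "(\<Sum>\<alpha>\<in>S. v \<alpha> * W \<alpha> a * t + (\<Sum>\<beta>\<in>S. v \<alpha> * W \<alpha> \<beta> * v \<beta>))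
      = t * (\<Sum>\<beta>\<in>S. W a \<beta> * v \<beta>) + (\<Sum>\<alpha>\<in>S. \<Sum>\<beta>\<in>S. v \<alpha> * W \<alpha> \<beta> * v \<beta>)"
    by (auto simp: sum.distrib sum_distrib_left psd_onD_sym[OF assms(1), of _ a] intro!: sum.cong)
  also have "(\<Sum>\<beta>\<in>S. t * W a \<beta> * v \<beta>) = t * (\<Sum>\<beta>\<in>S. W a \<beta> * v \<beta>)"
    by (simp add: sum_distrib_left mult.assoc)
  finally show ?thesis
    using psd_onD_nonneg[OF assms(1), of u] by (simp add: power2_eq_square algebra_simps)
qed

lemma psd_on_diag_nonneg:
  assumes "psd_on S W" "finite S" "a \<in> S"
  shows "0 \<le> W a a"
proof -
  have "psd_on (insert a {}) W" using assms by (intro psd_on_subset[OF assms(1)]) auto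
  from psd_on_insert_quadratic[OF this, of 1 "\<lambda>_. 0"] show ?thesis by simp
qed

lemma nonneg_quadratic_discriminant:
  fixes A B C :: real
  assumes "\<And>t. 0 \<le> t\<^sup>2 * A + 2 * t * B + C" "0 \<le> A"
  shows "B\<^sup>2 \<le> A * C"
proof (cases "A = 0")
  case True
  have "B = 0"
  proof (rule ccontr)
    assume "B \<noteq> 0"
    \<comment> \<open>This test point makes the remaining affine function of \<open>t\<close> equal
      to -1.\<close>
    then show False using assms(1)[of "- (C + 1) / (2 * B)"] True by (simp add: field_simps)
  qed
  then show ?thesis using True by simp
next
  case False
  then have "A > 0" using assms(2) by simp
  then show ?thesis
    using assms(1)[of "- B / A"] by (simp add: field_simps power2_eq_square)
qed

lemma psd_on_cauchy_schwarz:
  assumes "psd_on S W" "finite S" "a \<in> S" "b \<in> S"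
  shows "(W a b)\<^sup>2 \<le> W a a * W b b"
proof (cases "a = b")
  case False
  have "psd_on (insert a {b}) W" using assms by (intro psd_on_subset[OF assms(1)]) auto
  from psd_on_insert_quadratic[OF this, of _ "\<lambda>_. 1"] False
  have "0 \<le> t\<^sup>2 * W a a + 2 * t * W a b + W b b" for t by auto
  then show ?thesis
    using psd_on_diag_nonneg[OF assms(1-3)] by (rule nonneg_quadratic_discriminant)
qed (simp add: power2_eq_square)

text \<open>A Cholesky step in each induction step: subtracting a rank-one matrix clears row
  \<open>a\<close>, and the Schur complement left on \<open>S\<close> is positive semidefinite by
  the discriminant bound.\<close>

lemma psd_on_decomposition:
  assumes "finite S" "psd_on S W"
  shows "\<exists>ws :: ('a \<Rightarrow> real) list. \<forall>\<alpha>\<in>S. \<forall>\<beta>\<in>S. W \<alpha> \<beta> = (\<Sum>w\<leftarrow>ws. w \<alpha> * w \<beta>)"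
  using assms
proof (induction S arbitrary: W rule: finite_induct)
  case (insert a S)
  \<comment> \<open>If \<open>W a a = 0\<close>, division by zero makes \<open>w0\<close> vanish;
    \<open>row\<close> below shows that row \<open>a\<close> of \<open>W\<close> is then zero as
    well.\<close>
  define w0 where "w0 \<beta> = W a \<beta> / sqrt (W a a)" for \<beta>
  define W' where "W' \<alpha> \<beta> = W \<alpha> \<beta> - w0 \<alpha> * w0 \<beta>" for \<alpha> \<beta>
  have A: "0 \<le> W a a"
    using insert by (intro psd_on_diag_nonneg[of "insert a S"]) auto
  have w0w0: "w0 \<alpha> * w0 \<beta> = W a \<alpha> * W a \<beta> / W a a" for \<alpha> \<beta>
    using A by (simp add: w0_def)
  have "psd_on S W'"
    unfolding psd_on_def
  proof (intro conjI ballI allI)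
    show "W' \<alpha> \<beta> = W' \<beta> \<alpha>" if "\<alpha> \<in> S" "\<beta> \<in> S" for \<alpha> \<beta>
      using psd_onD_sym[OF insert.prems, of \<alpha> \<beta>] that by (simp add: W'_def)
    fix v :: "'a \<Rightarrow> real"
    define B where "B = (\<Sum>\<beta>\<in>S. W a \<beta> * v \<beta>)"
    define C where "C = (\<Sum>\<alpha>\<in>S. \<Sum>\<beta>\<in>S. v \<alpha> * W \<alpha> \<beta> * v \<beta>)"
    have "B\<^sup>2 \<le> W a a * C"
      using psd_on_insert_quadratic[OF insert.prems insert.hyps, of _ v] A
      unfolding B_def C_def by (rule nonneg_quadratic_discriminant)
    moreover have "0 \<le> C"
      using psd_onD_nonneg[OF psd_on_subset[OF insert.prems, of S]] insert.hyps by (auto simp: C_def)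
    ultimately have "B\<^sup>2 / W a a \<le> C"
      using A by (cases "W a a = 0") (auto simp: field_simps)
    moreover have "(\<Sum>\<alpha>\<in>S. \<Sum>\<beta>\<in>S. v \<alpha> * W' \<alpha> \<beta> * v \<beta>) = C - B\<^sup>2 / W a a"
      by (simp add: W'_def w0w0 C_def B_def power2_eq_square sum_product sum_divide_distrib
            sum_subtractf [symmetric] algebra_simps)
    ultimately show "0 \<le> (\<Sum>\<alpha>\<in>S. \<Sum>\<beta>\<in>S. v \<alpha> * W' \<alpha> \<beta> * v \<beta>)" by simp
  qed
  from insert.IH[OF this] obtain ws
    where ws: "\<And>\<alpha> \<beta>. \<alpha> \<in> S \<Longrightarrow> \<beta> \<in> S \<Longrightarrow> W' \<alpha> \<beta> = (\<Sum>w\<leftarrow>ws. w \<alpha> * w \<beta>)" by blast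
  \<comment> \<open>The vectors from the induction hypothesis are arbitrary at \<open>a\<close>;
    resetting them to 0 there leaves row \<open>a\<close> to \<open>w0\<close> alone.\<close>
  define us where "us = map (\<lambda>w. w(a := 0)) ws"
  have us: "(\<Sum>w\<leftarrow>us. w \<alpha> * w \<beta>) = (if \<alpha> = a \<or> \<beta> = a then 0 else \<Sum>w\<leftarrow>ws. w \<alpha> * w \<beta>)" for \<alpha> \<beta>
    by (auto simp: us_def o_def)
  have row: "W a \<beta> = w0 a * w0 \<beta>" if "\<beta> \<in> insert a S" for \<beta>
  proof (cases "W a a = 0")
    case True
    then have "(W a \<beta>)\<^sup>2 \<le> 0"
      using psd_on_cauchy_schwarz[OF insert.prems, of a \<beta>] that insert.hyps by auto
    then show ?thesis using True by (simp add: w0w0)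
  qed (simp add: w0w0)
  have "W \<alpha> \<beta> = (\<Sum>w\<leftarrow>w0 # us. w \<alpha> * w \<beta>)" if "\<alpha> \<in> insert a S" "\<beta> \<in> insert a S" for \<alpha> \<beta>
  proof (cases "\<alpha> = a \<or> \<beta> = a")
    case True
    then show ?thesis
      using row that psd_onD_sym[OF insert.prems, of \<alpha> a]
      by (auto simp: us mult.commute)
  next
    case False
    then show ?thesis using that by (auto simp: us ws[symmetric] W'_def)
  qed
  then show ?case by blast
qed auto

lemma psd_on_rank_one: "psd_on S (\<lambda>\<alpha> \<beta>. w \<alpha> * w \<beta>)"
proof -
  have "(\<Sum>\<alpha>\<in>S. \<Sum>\<beta>\<in>S. v \<alpha> * (w \<alpha> * w \<beta>) * v \<beta>) = (\<Sum>\<alpha>\<in>S. v \<alpha> * w \<alpha>)\<^sup>2" for v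
    by (simp add: power2_eq_square sum_product algebra_simps)
  then show ?thesis by (simp add: psd_on_def)
qed

text \<open>One half of the self-duality of the positive semidefinite cone: splitting
  \<open>W\<close> into rank-one terms turns the pairing into a sum of values of the quadratic form
  of \<open>M\<close>.\<close>

lemma psd_on_frobenius_nonneg:
  assumes "finite S" "psd_on S W" "psd_on S M"
  shows "0 \<le> (\<Sum>\<alpha>\<in>S. \<Sum>\<beta>\<in>S. W \<alpha> \<beta> * M \<alpha> \<beta>)"
proof -
  obtain ws :: "('a \<Rightarrow> real) list"
    where ws: "\<And>\<alpha> \<beta>. \<alpha> \<in> S \<Longrightarrow> \<beta> \<in> S \<Longrightarrow> W \<alpha> \<beta> = (\<Sum>w\<leftarrow>ws. w \<alpha> * w \<beta>)"
    using psd_on_decomposition[OF assms(1,2)] by blast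
  have "(\<Sum>\<alpha>\<in>S. \<Sum>\<beta>\<in>S. (\<Sum>w\<leftarrow>ws. w \<alpha> * w \<beta>) * M \<alpha> \<beta>) = (\<Sum>w\<leftarrow>ws. \<Sum>\<alpha>\<in>S. \<Sum>\<beta>\<in>S. w \<alpha> * M \<alpha> \<beta> * w \<beta>)"
    by (induction ws) (simp_all add: sum.distrib algebra_simps)
  also have "\<dots> \<ge> 0"
    using psd_onD_nonneg[OF assms(3)] by (intro sum_list_nonneg) auto
  finally show ?thesis by (simp add: ws)
qed

lemma psd_on_add:
  assumes "psd_on S V" "psd_on S W"
  shows "psd_on S (\<lambda>\<alpha> \<beta>. V \<alpha> \<beta> + W \<alpha> \<beta>)"
proof -
  have "(\<Sum>\<alpha>\<in>S. \<Sum>\<beta>\<in>S. v \<alpha> * (V \<alpha> \<beta> + W \<alpha> \<beta>) * v \<beta>) =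
    (\<Sum>\<alpha>\<in>S. \<Sum>\<beta>\<in>S. v \<alpha> * V \<alpha> \<beta> * v \<beta>) + (\<Sum>\<alpha>\<in>S. \<Sum>\<beta>\<in>S. v \<alpha> * W \<alpha> \<beta> * v \<beta>)" for v
    by (simp add: algebra_simps sum.distrib)
  then show ?thesis using assms by (simp add: psd_on_def)
qed

lemma psd_on_scale:
  assumes "psd_on S W" "0 \<le> c"
  shows "psd_on S (\<lambda>\<alpha> \<beta>. c * W \<alpha> \<beta>)"
proof -
  have "(\<Sum>\<alpha>\<in>S. \<Sum>\<beta>\<in>S. v \<alpha> * (c * W \<alpha> \<beta>) * v \<beta>) =
    c * (\<Sum>\<alpha>\<in>S. \<Sum>\<beta>\<in>S. v \<alpha> * W \<alpha> \<beta> * v \<beta>)" for v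
    by (simp add: algebra_simps sum_distrib_left)
  then show ?thesis using assms by (simp add: psd_on_def)
qed

lemma psd_on_cong:
  assumes "\<And>\<alpha> \<beta>. \<alpha> \<in> S \<Longrightarrow> \<beta> \<in> S \<Longrightarrow> V \<alpha> \<beta> = W \<alpha> \<beta>"
  shows "psd_on S V \<longleftrightarrow> psd_on S W"
  unfolding psd_on_def using assms by (simp cong: sum.cong)

section \<open>Linear functionals on polynomials\<close>

definition riesz :: "('n::finite expo \<Rightarrow> real) \<Rightarrow> 'n rpoly \<Rightarrow> real" where
  "riesz y p = (\<Sum>\<alpha>\<in>supp p. coeff p \<alpha> * y \<alpha>)"

lemma riesz_superset:
  assumes "finite T" "supp p \<subseteq> T"
  shows "(\<Sum>\<alpha>\<in>T. coeff p \<alpha> * y \<alpha>) = riesz y p"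
  unfolding riesz_def using assms
  by (intro sum.mono_neutral_right) (auto simp: in_keys_iff)

lemma riesz_add: "riesz y (p + q) = riesz y p + riesz y q"
proof -
  have "riesz y r = (\<Sum>\<alpha>\<in>supp p \<union> supp q \<union> supp (p + q). coeff r \<alpha> * y \<alpha>)"
    if "r \<in> {p, q, p + q}" for r
    using that by (intro riesz_superset[symmetric]) auto
  then show ?thesis by (simp add: lookup_add algebra_simps sum.distrib)
qed

lemma riesz_zero [simp]: "riesz y 0 = 0"
  by (simp add: riesz_def)

lemma riesz_uminus: "riesz y (- p) = - riesz y p"
  using riesz_add[of y p "- p"] by simp

lemma riesz_diff: "riesz y (p - q) = riesz y p - riesz y q"
  using riesz_add[of y p "- q"] by (simp add: riesz_uminus)

lemma riesz_sum: "riesz y (sum p I) = (\<Sum>i\<in>I. riesz y (p i))"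
  by (induction I rule: infinite_finite_induct) (simp_all add: riesz_add)

lemma riesz_single [simp]: "riesz y (Poly_Mapping.single \<alpha> c) = c * y \<alpha>"
  by (simp add: riesz_def)

lemma gram_poly_alt: "gram_poly S W = (\<Sum>\<alpha>\<in>S. \<Sum>\<beta>\<in>S. Poly_Mapping.single (\<alpha> + \<beta>) (W \<alpha> \<beta>))"
  by (simp add: gram_poly_def Monom_def Const_def mult_single)

text \<open>The right-hand side is the Frobenius pairing of \<open>W\<close> with the moment matrix
  of \<open>y\<close>, the adjoint relation on which the duality rests.\<close>

lemma riesz_gram_poly: "riesz y (gram_poly S W) = (\<Sum>\<alpha>\<in>S. \<Sum>\<beta>\<in>S. W \<alpha> \<beta> * y (\<alpha> + \<beta>))"
  by (simp add: gram_poly_alt riesz_sum)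

lemma riesz_cong:
  assumes "\<And>\<alpha>. \<alpha> \<in> supp p \<Longrightarrow> y \<alpha> = z \<alpha>"
  shows "riesz y p = riesz z p"
  using assms by (simp add: riesz_def)

section \<open>Separation from the Gram cone\<close>

definition expo_sqnorm :: "'n::finite expo \<Rightarrow> nat" where
  "expo_sqnorm \<alpha> = (\<Sum>j\<in>UNIV. (\<alpha> $ j)\<^sup>2)"

lemma expo_sqnorm_add_self: "expo_sqnorm (\<alpha> + \<alpha>) = 2 * expo_sqnorm \<alpha> + 2 * expo_sqnorm \<alpha>"
proof -
  have "(a + a)\<^sup>2 = 4 * a\<^sup>2" for a :: nat
    by (simp add: power2_eq_square algebra_simps)
  then show ?thesis by (simp add: expo_sqnorm_def flip: sum_distrib_left)
qed

text \<open>Parallelogram law: the gap is the squared norm of the difference, computed over the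
  integers because subtraction of naturals is truncated. A strict inequality of naturals leaves a
  gap of at least 1, which later gains a whole factor \<open>M\<close>.\<close>

lemma expo_sqnorm_add_less:
  assumes "\<alpha> \<noteq> \<beta>"
  shows "expo_sqnorm (\<alpha> + \<beta>) < 2 * expo_sqnorm \<alpha> + 2 * expo_sqnorm \<beta>"
proof -
  have eq: "int (2 * a\<^sup>2 + 2 * b\<^sup>2) = int ((a + b)\<^sup>2) + (int a - int b)\<^sup>2" for a b :: nat
    by (simp add: power2_eq_square algebra_simps)
  have le: "(a + b)\<^sup>2 \<le> 2 * a\<^sup>2 + 2 * b\<^sup>2" for a b :: nat
    using eq[of a b] zero_le_power2[of "int a - int b"] by linarith
  have less: "(a + b)\<^sup>2 < 2 * a\<^sup>2 + 2 * b\<^sup>2" if "a \<noteq> b" for a b :: nat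
  proof -
    have "0 < (int a - int b)\<^sup>2" using that by simp
    with eq[of a b] show ?thesis by linarith
  qed
  obtain k where "\<alpha> $ k \<noteq> \<beta> $ k" using assms by (auto simp: vec_eq_iff)
  then have "(\<Sum>j\<in>UNIV. ((\<alpha> + \<beta>) $ j)\<^sup>2) < (\<Sum>j\<in>UNIV. 2 * (\<alpha> $ j)\<^sup>2 + 2 * (\<beta> $ j)\<^sup>2)"
    by (intro sum_strict_mono_ex1 bexI[of _ k]) (auto simp: le less)
  then show ?thesis
    by (simp add: expo_sqnorm_def sum.distrib sum_distrib_left)
qed

text \<open>
  For large \<open>M\<close> the moment matrix of \<open>\<alpha> \<mapsto> M ^ |\<alpha>|\<^sup>2\<close> is positive definite: by strict convexity of
  \<open>|\<cdot>|\<^sup>2\<close> it is diagonally dominant after scaling.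
\<close>

lemma trace_le_riesz_gram_poly:
  assumes "finite S" "psd_on S W" "1 \<le> M" "2 * real (card S) \<le> M"
  shows "(\<Sum>\<alpha>\<in>S. W \<alpha> \<alpha>) \<le> 2 * riesz (\<lambda>\<alpha>. M ^ expo_sqnorm \<alpha>) (gram_poly S W)"
proof -
  \<comment> \<open>Scaled so that the square of \<open>u \<alpha>\<close> is the diagonal term of
    the pairing at \<open>\<alpha>\<close>.\<close>
  define u where "u \<alpha> = sqrt (W \<alpha> \<alpha>) * M ^ (2 * expo_sqnorm \<alpha>)" for \<alpha>
  define U where "U = (\<Sum>\<alpha>\<in>S. (u \<alpha>)\<^sup>2)"
  have W0: "0 \<le> W \<alpha> \<alpha>" if "\<alpha> \<in> S" for \<alpha>
    using psd_on_diag_nonneg[OF assms(2,1) that] .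
  have M0: "0 < M" using assms by simp
  have diag: "W \<alpha> \<alpha> * M ^ expo_sqnorm (\<alpha> + \<alpha>) = (u \<alpha>)\<^sup>2" if "\<alpha> \<in> S" for \<alpha>
    using W0[OF that]
    by (simp add: u_def power_mult_distrib expo_sqnorm_add_self flip: power_mult)
  \<comment> \<open>Off the diagonal, the gap in the exponents gains a factor \<open>M\<close>, and
    the arithmetic-geometric mean inequality does the rest. On the diagonal the subtracted term only
    weakens the bound, but it keeps the double sum uniform.\<close>
  have entry: "(if \<alpha> = \<beta> then (u \<alpha>)\<^sup>2 else 0) - ((u \<alpha>)\<^sup>2 + (u \<beta>)\<^sup>2) / (2 * M)
      \<le> W \<alpha> \<beta> * M ^ expo_sqnorm (\<alpha> + \<beta>)" if S: "\<alpha> \<in> S" "\<beta> \<in> S" for \<alpha> \<beta>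
  proof (cases "\<alpha> = \<beta>")
    case True
    then show ?thesis using diag[OF S(1)] M0 by simp
  next
    case False
    have "\<bar>W \<alpha> \<beta>\<bar> \<le> sqrt (W \<alpha> \<alpha> * W \<beta> \<beta>)"
      using psd_on_cauchy_schwarz[OF assms(2,1) S] by (intro real_le_rsqrt) simp
    then have "\<bar>W \<alpha> \<beta>\<bar> * M ^ expo_sqnorm (\<alpha> + \<beta>) * M
        \<le> sqrt (W \<alpha> \<alpha> * W \<beta> \<beta>) * M ^ Suc (expo_sqnorm (\<alpha> + \<beta>))"
      using M0 by (simp add: mult_right_mono)
    also have "\<dots> \<le> sqrt (W \<alpha> \<alpha> * W \<beta> \<beta>) * M ^ (2 * expo_sqnorm \<alpha> + 2 * expo_sqnorm \<beta>)"
      using expo_sqnorm_add_less[OF False] assms(3) W0 S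
      by (intro mult_left_mono power_increasing) auto
    also have "\<dots> = u \<alpha> * u \<beta>"
      by (simp add: u_def real_sqrt_mult power_add)
    also have "\<dots> \<le> ((u \<alpha>)\<^sup>2 + (u \<beta>)\<^sup>2) / 2"
      using sum_squares_bound[of "u \<alpha>" "u \<beta>"] by simp
    finally have "\<bar>W \<alpha> \<beta>\<bar> * M ^ expo_sqnorm (\<alpha> + \<beta>) \<le> ((u \<alpha>)\<^sup>2 + (u \<beta>)\<^sup>2) / (2 * M)"
      using M0 by (simp add: field_simps)
    moreover have "- (\<bar>W \<alpha> \<beta>\<bar> * M ^ expo_sqnorm (\<alpha> + \<beta>)) \<le> W \<alpha> \<beta> * M ^ expo_sqnorm (\<alpha> + \<beta>)"
      using mult_right_mono[of "- \<bar>W \<alpha> \<beta>\<bar>" "W \<alpha> \<beta>" "M ^ expo_sqnorm (\<alpha> + \<beta>)"] M0 by simp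
    ultimately show ?thesis using False by simp
  qed
  \<comment> \<open>The choice of \<open>M\<close> lets the subtracted terms consume at most half of
    \<open>U\<close>.\<close>
  have "(\<Sum>\<alpha>\<in>S. \<Sum>\<beta>\<in>S. ((u \<alpha>)\<^sup>2 + (u \<beta>)\<^sup>2) / (2 * M)) = real (card S) / M * U"
    by (simp add: sum_divide_distrib[symmetric] sum.distrib U_def sum_distrib_left[symmetric])
  also have "\<dots> \<le> 1 / 2 * U"
    using assms(4) M0 by (intro mult_right_mono) (auto simp: U_def sum_nonneg field_simps)
  finally have "U - 1 / 2 * U
      \<le> (\<Sum>\<alpha>\<in>S. \<Sum>\<beta>\<in>S. (if \<alpha> = \<beta> then (u \<alpha>)\<^sup>2 else 0) - ((u \<alpha>)\<^sup>2 + (u \<beta>)\<^sup>2) / (2 * M))"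
    using assms(1) by (simp add: sum_subtractf U_def)
  also have "\<dots> \<le> riesz (\<lambda>\<alpha>. M ^ expo_sqnorm \<alpha>) (gram_poly S W)"
    unfolding riesz_gram_poly by (intro sum_mono entry)
  finally have "U \<le> 2 * riesz (\<lambda>\<alpha>. M ^ expo_sqnorm \<alpha>) (gram_poly S W)" by simp
  moreover have "(\<Sum>\<alpha>\<in>S. W \<alpha> \<alpha>) \<le> U"
    unfolding U_def
  proof (rule sum_mono)
    fix \<alpha> assume "\<alpha> \<in> S"
    then show "W \<alpha> \<alpha> \<le> (u \<alpha>)\<^sup>2"
      using mult_left_mono[OF one_le_power[OF assms(3)] W0] by (simp flip: diag)
  qed
  ultimately show ?thesis by simp
qed

text \<open>Generic in the family \<open>S\<close>, so that the sparse and the sparser SOS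
  relaxation are instances of one conic program.\<close>

definition gram_cone :: "'i set \<Rightarrow> ('i \<Rightarrow> 'n::finite expo set) \<Rightarrow> 'n rpoly set" where
  "gram_cone I S =
     {p. \<exists>W. (\<forall>i\<in>I. psd_on (S i) (W i)) \<and> p = (\<Sum>i\<in>I. gram_poly (S i) (W i))}"

definition psd_moments :: "'i set \<Rightarrow> ('i \<Rightarrow> 'n::finite expo set) \<Rightarrow> ('n expo \<Rightarrow> real) \<Rightarrow> bool" where
  "psd_moments I S y \<longleftrightarrow> (\<forall>i\<in>I. psd_on (S i) (moment_matrix y))"

text \<open>Weak duality: each block contributes the Frobenius pairing of two positive semidefinite
  matrices.\<close>

lemma riesz_gram_cone_nonneg:
  assumes "\<And>i. i \<in> I \<Longrightarrow> finite (S i)" "psd_moments I S y" "p \<in> gram_cone I S"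
  shows "0 \<le> riesz y p"
proof -
  obtain W where W: "\<forall>i\<in>I. psd_on (S i) (W i)" "p = (\<Sum>i\<in>I. gram_poly (S i) (W i))"
    using assms(3) by (auto simp: gram_cone_def)
  have "0 \<le> riesz y (gram_poly (S i) (W i))" if "i \<in> I" for i
    using psd_on_frobenius_nonneg[of "S i" "W i" "moment_matrix y"] assms(1,2) W that
    by (auto simp: riesz_gram_poly psd_moments_def moment_matrix_def)
  then show ?thesis by (auto simp: W(2) riesz_sum intro!: sum_nonneg)
qed

section \<open>Compactness and closedness for families of matrices\<close>

lemma compact_box_fun: "compact {x :: 'a \<Rightarrow> real. \<forall>k. \<bar>x k\<bar> \<le> B}"
proof -
  \<comment> \<open>Tychonoff: the index type may be infinite, so compactness is taken in the
    product topology.\<close>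
  have "compactin (product_topology (\<lambda>_. euclidean) UNIV) (PiE UNIV (\<lambda>_ :: 'a. {-B..B}))"
    by (subst compactin_PiE) (auto simp: compactin_euclidean_iff)
  moreover have "PiE UNIV (\<lambda>_ :: 'a. {-B..B}) = {x. \<forall>k. \<bar>x k\<bar> \<le> B}"
    by (auto simp: PiE_iff abs_le_iff minus_le_iff)
  ultimately show ?thesis
    by (simp add: euclidean_product_topology compactin_euclidean_iff)
qed

lemma continuous_on_fun_coordinate [continuous_intros]:
  "continuous_on A (\<lambda>x :: 'a \<Rightarrow> 'b::topological_space. x k)"
  by (rule continuous_on_product_coordinates[THEN continuous_on_subset]) simp

lemma closed_Collect_ball:
  "(\<And>i. i \<in> I \<Longrightarrow> closed {x. P i x}) \<Longrightarrow> closed {x. \<forall>i\<in>I. P i x}"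
  by (simp add: Collect_ball_eq closed_INT)

lemma closed_psd_on_slices:
  "closed {x :: 'i \<times> 'a \<times> 'a \<Rightarrow> real. \<forall>i\<in>I. psd_on (S i) (\<lambda>\<alpha> \<beta>. x (i, \<alpha>, \<beta>))}"
  unfolding psd_on_def
  by (intro closed_Collect_ball closed_Collect_conj closed_Collect_all closed_Collect_eq
        closed_Collect_le continuous_intros)

lemma coeff_gram_poly:
  "coeff (gram_poly S W) t = (\<Sum>\<alpha>\<in>S. \<Sum>\<beta>\<in>S. if \<alpha> + \<beta> = t then W \<alpha> \<beta> else 0)"
  by (simp add: gram_poly_alt lookup_sum lookup_single when_def)

lemma supp_gram_poly: "supp (gram_poly S W) \<subseteq> (\<lambda>(\<alpha>, \<beta>). \<alpha> + \<beta>) ` (S \<times> S)"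
proof
  fix t assume t: "t \<in> supp (gram_poly S W)"
  show "t \<in> (\<lambda>(\<alpha>, \<beta>). \<alpha> + \<beta>) ` (S \<times> S)"
  proof (rule ccontr)
    assume "\<not> ?thesis"
    then have "\<alpha> + \<beta> \<noteq> t" if "\<alpha> \<in> S" "\<beta> \<in> S" for \<alpha> \<beta>
      using that by force
    then have "coeff (gram_poly S W) t = 0"
      unfolding coeff_gram_poly by (intro sum.neutral ballI) simp
    with t show False by (simp add: in_keys_iff)
  qed
qed

lemma gram_poly_cong:
  assumes "\<And>\<alpha> \<beta>. \<alpha> \<in> S \<Longrightarrow> \<beta> \<in> S \<Longrightarrow> V \<alpha> \<beta> = W \<alpha> \<beta>"
  shows "gram_poly S V = gram_poly S W"
  unfolding gram_poly_def using assms by (intro sum.cong) auto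

text \<open>First-order optimality: dividing by \<open>s\<close> and letting it tend to 0 leaves
  \<open>0 \<le> - 2 * B\<close>. The proof replaces the limit by one explicit small
  \<open>s\<close>.\<close>

lemma linear_term_nonpos:
  fixes A B :: real
  assumes "\<And>s. 0 < s \<Longrightarrow> s \<le> 1 \<Longrightarrow> 0 \<le> s\<^sup>2 * A - 2 * s * B"
  shows "B \<le> 0"
proof (rule ccontr)
  assume "\<not> B \<le> 0"
  define s where "s = min 1 (B / (\<bar>A\<bar> + 1))"
  have s: "0 < s" "s \<le> 1" "s \<le> B / (\<bar>A\<bar> + 1)"
    using \<open>\<not> B \<le> 0\<close> by (auto simp: s_def)
  have "s * (\<bar>A\<bar> + 1) \<le> B"
    using s(3) by (subst (asm) pos_le_divide_eq) auto
  have "s * A \<le> s * (\<bar>A\<bar> + 1)" using s(1) by (intro mult_left_mono) auto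
  then have "s * A < 2 * B" using \<open>s * (\<bar>A\<bar> + 1) \<le> B\<close> \<open>\<not> B \<le> 0\<close> by linarith
  then have "s * (s * A) < s * (2 * B)" using s(1) by simp
  then show False using assms[OF s(1,2)] by (simp add: power2_eq_square algebra_simps)
qed

text \<open>
  The functional is the negated residual of a point of the cone nearest to \<open>g\<close>. Such a point exists
  because the trace bound confines the relevant matrices to a compact set.
\<close>

lemma gram_cone_separation:
  fixes g :: "'n::finite rpoly"
  assumes I: "finite I" and S: "\<And>i. i \<in> I \<Longrightarrow> finite (S i)" and g: "g \<notin> gram_cone I S"
  obtains y where "psd_moments I S y" "riesz y g < 0"
proof -
  \<comment> \<open>A single function on triples encodes all matrices at once, so that the product
    topology applies to whole families.\<close>
  define \<Phi> where "\<Phi> x = (\<Sum>i\<in>I. gram_poly (S i) (\<lambda>\<alpha> \<beta>. x (i, \<alpha>, \<beta>)))"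
    for x :: "'a \<times> 'n expo \<times> 'n expo \<Rightarrow> real"
  define P where "P = {x :: 'a \<times> 'n expo \<times> 'n expo \<Rightarrow> real. \<forall>i\<in>I. psd_on (S i) (\<lambda>\<alpha> \<beta>. x (i, \<alpha>, \<beta>))}"
  define T where "T = supp g \<union> (\<Union>i\<in>I. (\<lambda>(\<alpha>, \<beta>). \<alpha> + \<beta>) ` (S i \<times> S i))"
  \<comment> \<open>The squared Euclidean distance of coefficients from \<open>g\<close> to
    \<open>\<Phi> x\<close>; \<open>T\<close> contains the support of every residual.\<close>
  define F where "F x = (\<Sum>t\<in>T. (coeff (g - \<Phi> x) t)\<^sup>2)" for x
  define M where "M = 1 + (\<Sum>i\<in>I. 2 * real (card (S i)))"
  define L where "L = riesz (\<lambda>\<alpha> :: 'n expo. M ^ expo_sqnorm \<alpha>)"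
  \<comment> \<open>For a family no worse than the zero family, each residual coefficient has
    absolute value at most \<open>sqrt (F (\<lambda>_. 0))\<close>. This bounds
    \<open>2 * L (\<Phi> x)\<close>, and hence the traces, by \<open>B\<close>.\<close>
  define B where "B = 2 * (\<bar>L g\<bar> + (\<Sum>t\<in>T. sqrt (F (\<lambda>_. 0)) * M ^ expo_sqnorm t))"
  have finT: "finite T" using I S by (auto simp: T_def)
  have M: "1 \<le> M" by (auto simp: M_def sum_nonneg)
  have Mcard: "2 * real (card (S i)) \<le> M" if "i \<in> I" for i
    using member_le_sum[of i I "\<lambda>i. 2 * real (card (S i))"] I that by (simp add: M_def)
  have supp\<Phi>: "supp (\<Phi> x) \<subseteq> T" for x
  proof -
    have "supp (\<Phi> x) \<subseteq> (\<Union>i\<in>I. supp (gram_poly (S i) (\<lambda>\<alpha> \<beta>. x (i, \<alpha>, \<beta>))))"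
      unfolding \<Phi>_def by (rule keys_sum)
    also have "\<dots> \<subseteq> (\<Union>i\<in>I. (\<lambda>(\<alpha>, \<beta>). \<alpha> + \<beta>) ` (S i \<times> S i))"
      by (intro UN_mono order_refl supp_gram_poly)
    finally show ?thesis by (simp add: T_def le_supI2)
  qed
  have suppr: "supp (g - \<Phi> x) \<subseteq> T" for x
    using keys_diff[of g "\<Phi> x"] supp\<Phi>[of x] by (auto simp: T_def)
  have coeff\<Phi>: "coeff (\<Phi> (\<lambda>k. x k + s * v k)) t = coeff (\<Phi> x) t + s * coeff (\<Phi> v) t" for x s v t
  proof -
    have "(if P then x k + s * v k else 0) = (if P then x k else 0) + s * (if P then v k else 0)" for P k
      by simp
    then show ?thesis
      by (simp only: \<Phi>_def lookup_sum coeff_gram_poly sum.distrib sum_distrib_left)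
  qed
  have contF: "continuous_on A F" for A
  proof -
    have "continuous_on A (\<lambda>x. if Q then x k else 0)"
      for Q and k :: "'a \<times> 'n expo \<times> 'n expo" and A :: "('a \<times> 'n expo \<times> 'n expo \<Rightarrow> real) set"
      by (cases Q) (auto intro: continuous_intros)
    then show ?thesis
      unfolding F_def \<Phi>_def lookup_minus lookup_sum coeff_gram_poly
      by (intro continuous_intros)
  qed
  define K where "K = P \<inter> {x. \<forall>k. \<bar>x k\<bar> \<le> B}"
  have "compact K"
    unfolding K_def P_def by (intro closed_Int_compact closed_psd_on_slices compact_box_fun)
  moreover have F0: "0 \<le> F x" for x by (auto simp: F_def sum_nonneg)
  have B: "0 \<le> B" using M F0 by (auto simp: B_def intro!: add_nonneg_nonneg sum_nonneg)
  have zeroK: "(\<lambda>_. 0) \<in> K" using B by (auto simp: K_def P_def psd_on_def)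
  ultimately obtain x0 where x0: "x0 \<in> K" and min: "\<And>x. x \<in> K \<Longrightarrow> F x0 \<le> F x"
    using continuous_attains_inf[of K F] contF by blast
  have x0P: "x0 \<in> P" using x0 by (simp add: K_def)
  \<comment> \<open>The trace bounds the diagonal entries, and Cauchy-Schwarz then bounds the
    others.\<close>
  have P_bounded: "\<bar>x (i, \<alpha>, \<beta>)\<bar> \<le> B"
    if "x \<in> P" "F x \<le> F (\<lambda>_. 0)" "i \<in> I" "\<alpha> \<in> S i" "\<beta> \<in> S i" for x i \<alpha> \<beta>
  proof -
    have psd: "psd_on (S j) (\<lambda>\<alpha> \<beta>. x (j, \<alpha>, \<beta>))" if "j \<in> I" for j
      using \<open>x \<in> P\<close> that by (simp add: P_def)
    define tr where "tr j = (\<Sum>\<alpha>\<in>S j. x (j, \<alpha>, \<alpha>))" for j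
    have diag: "0 \<le> x (j, \<gamma>, \<gamma>)" if "j \<in> I" "\<gamma> \<in> S j" for j \<gamma>
      using psd_on_diag_nonneg[OF psd S] that by auto
    have "tr i \<le> (\<Sum>j\<in>I. tr j)"
      using \<open>i \<in> I\<close> I diag by (intro member_le_sum) (auto simp: tr_def intro!: sum_nonneg)
    also have "\<dots> \<le> (\<Sum>j\<in>I. 2 * L (gram_poly (S j) (\<lambda>\<alpha> \<beta>. x (j, \<alpha>, \<beta>))))"
      unfolding L_def tr_def using trace_le_riesz_gram_poly[OF S psd M Mcard] by (intro sum_mono)
    also have "\<dots> = 2 * L (\<Phi> x)"
      by (simp add: \<Phi>_def L_def riesz_sum sum_distrib_left)
    also have "\<dots> = 2 * (L g - L (g - \<Phi> x))"
      by (simp add: L_def riesz_diff)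
    also have "\<dots> \<le> B"
    proof -
      have "- coeff (g - \<Phi> x) t \<le> sqrt (F (\<lambda>_. 0))" if "t \<in> T" for t
      proof (rule real_le_rsqrt)
        have "(coeff (g - \<Phi> x) t)\<^sup>2 \<le> F x"
          unfolding F_def using finT that by (intro member_le_sum) auto
        then show "(- coeff (g - \<Phi> x) t)\<^sup>2 \<le> F (\<lambda>_. 0)"
          using \<open>F x \<le> F (\<lambda>_. 0)\<close> by simp
      qed
      then have "(\<Sum>t\<in>T. - coeff (g - \<Phi> x) t * M ^ expo_sqnorm t)
          \<le> (\<Sum>t\<in>T. sqrt (F (\<lambda>_. 0)) * M ^ expo_sqnorm t)"
        using M by (intro sum_mono mult_right_mono) auto
      then have "- L (g - \<Phi> x) \<le> (\<Sum>t\<in>T. sqrt (F (\<lambda>_. 0)) * M ^ expo_sqnorm t)"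
        by (simp add: L_def sum_negf flip: riesz_superset[OF finT suppr])
      then show ?thesis by (simp add: B_def)
    qed
    finally have tr: "tr i \<le> B" .
    have le: "x (i, \<gamma>, \<gamma>) \<le> B" if "\<gamma> \<in> S i" for \<gamma>
    proof -
      have "x (i, \<gamma>, \<gamma>) \<le> tr i"
        unfolding tr_def using that diag S \<open>i \<in> I\<close> by (intro member_le_sum) auto
      then show ?thesis using tr by simp
    qed
    have "(x (i, \<alpha>, \<beta>))\<^sup>2 \<le> x (i, \<alpha>, \<alpha>) * x (i, \<beta>, \<beta>)"
      using psd_on_cauchy_schwarz[OF psd S] that by auto
    also have "\<dots> \<le> B * B"
      using that diag le B by (intro mult_mono) auto
    finally show ?thesis
      using B by (simp add: abs_le_square_iff[of _ B, unfolded abs_of_nonneg[OF B]] power2_eq_square)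
  qed
  have minP: "F x0 \<le> F x" if "x \<in> P" for x
  proof (cases "F x \<le> F (\<lambda>_. 0)")
    case True
    \<comment> \<open>Entries outside \<open>S i \<times> S i\<close> are unconstrained in
      \<open>P\<close>. Clearing them leaves \<open>\<Phi> x\<close> unchanged and moves the family
      into the box.\<close>
    define x' where "x' k = (case k of (i, \<alpha>, \<beta>) \<Rightarrow>
      if i \<in> I \<and> \<alpha> \<in> S i \<and> \<beta> \<in> S i then x k else 0)" for k
    have "\<Phi> x' = \<Phi> x"
      unfolding \<Phi>_def by (intro sum.cong gram_poly_cong) (auto simp: x'_def)
    then have "F x' = F x" by (simp add: F_def)
    moreover have "psd_on (S i) (\<lambda>\<alpha> \<beta>. x' (i, \<alpha>, \<beta>))" if "i \<in> I" for i
    proof -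
      have "psd_on (S i) (\<lambda>\<alpha> \<beta>. x (i, \<alpha>, \<beta>))" using \<open>x \<in> P\<close> that by (simp add: P_def)
      then show ?thesis
        using that by (subst psd_on_cong[where W = "\<lambda>\<alpha> \<beta>. x (i, \<alpha>, \<beta>)"]) (auto simp: x'_def)
    qed
    then have "x' \<in> P" by (simp add: P_def)
    moreover have "\<bar>x' k\<bar> \<le> B" for k
      using P_bounded[OF \<open>x \<in> P\<close> True] B by (cases k) (auto simp: x'_def)
    ultimately show ?thesis using min[of x'] by (auto simp: K_def)
  qed (use min[OF zeroK] in linarith)
  define y where "y t = - coeff (g - \<Phi> x0) t" for t
  \<comment> \<open>First-order optimality of \<open>x0\<close> along an admissible direction
    \<open>v\<close>: the linear term of \<open>F\<close> is
    \<open>2 * s * riesz y (\<Phi> v)\<close>.\<close>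
  have y_feasible: "0 \<le> riesz y (\<Phi> v)"
    if "\<And>s. 0 < s \<Longrightarrow> s \<le> 1 \<Longrightarrow> (\<lambda>k. x0 k + s * v k) \<in> P" for v
  proof -
    have "0 \<le> s\<^sup>2 * (\<Sum>t\<in>T. (coeff (\<Phi> v) t)\<^sup>2) - 2 * s * (- riesz y (\<Phi> v))"
      if "0 < s" "s \<le> 1" for s
    proof -
      have "F (\<lambda>k. x0 k + s * v k)
          = F x0 + (s\<^sup>2 * (\<Sum>t\<in>T. (coeff (\<Phi> v) t)\<^sup>2) + 2 * s * (\<Sum>t\<in>T. coeff (\<Phi> v) t * y t))"
        unfolding F_def sum_distrib_left sum.distrib [symmetric] y_def
        by (intro sum.cong refl) (simp add: lookup_minus coeff\<Phi> power2_eq_square algebra_simps)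
      then show ?thesis
        using minP[OF \<open>\<And>s. 0 < s \<Longrightarrow> s \<le> 1 \<Longrightarrow> (\<lambda>k. x0 k + s * v k) \<in> P\<close>[OF that]]
        by (simp add: riesz_superset[OF finT supp\<Phi>])
    qed
    from linear_term_nonpos[OF this] show ?thesis by simp
  qed
  have "psd_moments I S y"
    unfolding psd_moments_def psd_on_def
  proof (intro ballI conjI allI)
    show "moment_matrix y \<alpha> \<beta> = moment_matrix y \<beta> \<alpha>" for \<alpha> \<beta>
      by (simp add: moment_matrix_def add.commute)
    fix i and w :: "'n expo \<Rightarrow> real"
    assume i: "i \<in> I"
    \<comment> \<open>Adding a rank-one matrix to block \<open>i\<close> stays in \<open>P\<close>;
      optimality in this direction says that the quadratic form of the moment matrix is nonnegative
      at \<open>w\<close>.\<close>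
    define v where "v k = (case k of (j, \<alpha>, \<beta>) \<Rightarrow> if j = i then w \<alpha> * w \<beta> else 0)" for k
    have "psd_on (S j) (\<lambda>\<alpha> \<beta>. v (j, \<alpha>, \<beta>))" for j
      by (cases "j = i") (simp add: v_def psd_on_rank_one, simp add: v_def psd_on_def)
    then have "0 \<le> riesz y (\<Phi> v)"
      using x0P by (intro y_feasible) (auto simp: P_def intro!: psd_on_add psd_on_scale)
    also have "riesz y (\<Phi> v) = (\<Sum>j\<in>I. if j = i then \<Sum>\<alpha>\<in>S i. \<Sum>\<beta>\<in>S i. w \<alpha> * w \<beta> * y (\<alpha> + \<beta>) else 0)"
      unfolding \<Phi>_def riesz_sum riesz_gram_poly by (intro sum.cong) (auto simp: v_def)
    finally show "0 \<le> (\<Sum>\<alpha>\<in>S i. \<Sum>\<beta>\<in>S i. w \<alpha> * moment_matrix y \<alpha> \<beta> * w \<beta>)"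
      using I i by (simp add: moment_matrix_def mult_ac)
  qed
  moreover have "riesz y g < 0"
  proof -
    \<comment> \<open>Shrinking \<open>x0\<close> towards 0 stays in \<open>P\<close>, which gives
      \<open>riesz y (\<Phi> x0) \<le> 0\<close>. The rest of \<open>riesz y g\<close> is minus the
      squared norm of the nonzero residual.\<close>
    have "(\<lambda>k. x0 k + s * - x0 k) \<in> P" if "0 < s" "s \<le> 1" for s
    proof -
      have "(\<lambda>k. x0 k + s * - x0 k) = (\<lambda>k. (1 - s) * x0 k)" by (auto simp: algebra_simps)
      then show ?thesis using x0P that by (auto simp: P_def intro!: psd_on_scale)
    qed
    then have "0 \<le> riesz y (\<Phi> (\<lambda>k. - x0 k))" by (intro y_feasible) auto
    also have "\<Phi> (\<lambda>k. - x0 k) = - \<Phi> x0"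
      using coeff\<Phi>[of "\<lambda>_. 0" "-1" x0] by (intro poly_mapping_eqI) (simp add: \<Phi>_def lookup_sum coeff_gram_poly)
    finally have "riesz y (\<Phi> x0) \<le> 0" by (simp add: riesz_uminus)
    moreover have "riesz y (g - \<Phi> x0) < 0"
    proof -
      have "g \<noteq> \<Phi> x0"
        using g x0P unfolding gram_cone_def P_def \<Phi>_def by auto
      then have "supp (g - \<Phi> x0) \<noteq> {}" by simp
      then have "0 < (\<Sum>t\<in>supp (g - \<Phi> x0). coeff (g - \<Phi> x0) t * coeff (g - \<Phi> x0) t)"
        by (intro sum_pos) (auto simp: in_keys_iff zero_less_mult_iff linorder_neq_iff)
      then show ?thesis by (simp add: riesz_def y_def sum_negf)
    qed
    ultimately show ?thesis by (simp add: riesz_diff)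
  qed
  ultimately show thesis by (rule that)
qed

section \<open>Duality\<close>

lemma riesz_Const: "riesz y (Const c) = c * y 0"
  by (simp add: Const_def)

lemma riesz_add_left: "riesz (\<lambda>\<alpha>. y \<alpha> + z \<alpha>) p = riesz y p + riesz z p"
  by (simp add: riesz_def algebra_simps sum.distrib)

lemma riesz_scale_left: "riesz (\<lambda>\<alpha>. c * y \<alpha>) p = c * riesz y p"
  by (simp add: riesz_def algebra_simps sum_distrib_left)

text \<open>The moments of the Dirac measure at the origin, a feasible point of every moment problem
  considered here.\<close>

definition dirac0 :: "'n::finite expo \<Rightarrow> real" where
  "dirac0 \<alpha> = (if \<alpha> = 0 then 1 else 0)"

lemma riesz_dirac0: "riesz dirac0 p = coeff p 0"
proof -
  have "riesz dirac0 p = (\<Sum>\<alpha>\<in>supp p. if \<alpha> = 0 then coeff p \<alpha> else 0)"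
    unfolding riesz_def by (intro sum.cong) (auto simp: dirac0_def)
  also have "\<dots> = coeff p 0" by (auto simp: in_keys_iff)
  finally show ?thesis .
qed

lemma expo_add_eq_0_iff: "\<alpha> + \<beta> = 0 \<longleftrightarrow> \<alpha> = 0 \<and> \<beta> = (0 :: 'n::finite expo)"
  by (auto simp: vec_eq_iff)

lemma psd_moments_dirac0: "psd_moments I (S :: 'i \<Rightarrow> 'n::finite expo set) dirac0"
proof -
  have "moment_matrix dirac0 = (\<lambda>\<alpha> \<beta> :: 'n expo. dirac0 \<alpha> * dirac0 \<beta>)"
    by (auto simp: fun_eq_iff moment_matrix_def dirac0_def expo_add_eq_0_iff)
  then show ?thesis by (simp add: psd_moments_def psd_on_rank_one)
qed

lemma psd_moments_add:
  assumes "psd_moments I S y" "psd_moments I S z"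
  shows "psd_moments I S (\<lambda>\<alpha>. y \<alpha> + z \<alpha>)"
  using assms psd_on_add[of _ "moment_matrix y" "moment_matrix z"]
  by (simp add: psd_moments_def moment_matrix_def [abs_def])

lemma psd_moments_scale:
  assumes "psd_moments I S y" "0 \<le> c"
  shows "psd_moments I S (\<lambda>\<alpha>. c * y \<alpha>)"
  using assms psd_on_scale[of _ "moment_matrix y" c]
  by (simp add: psd_moments_def moment_matrix_def [abs_def])

lemma psd_moments_zero_nonneg:
  assumes "psd_moments I S y" "i \<in> I" "finite (S i)" "0 \<in> S i"
  shows "0 \<le> y 0"
  using psd_on_diag_nonneg[of "S i" "moment_matrix y" 0] assms
  by (auto simp: psd_moments_def moment_matrix_def)

lemma affine_below:
  fixes a b c :: real
  assumes "b < 0"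
  obtains t where "0 \<le> t" "a + t * b < c"
proof
  show "0 \<le> (\<bar>a - c\<bar> + 1) / (- b)" using assms by (intro divide_nonneg_nonneg) auto
  show "a + (\<bar>a - c\<bar> + 1) / (- b) * b < c" using assms by simp
qed

text \<open>
  If no index set contains \<open>0\<close>, then \<open>y 0\<close> is unconstrained apart from \<open>y 0 = 1\<close>; duality then
  still holds provided \<open>f\<close> has no constant term, both values being \<open>0\<close> or \<open>-\<infinity>\<close>.
\<close>

theorem gram_moment_duality:
  fixes f :: "'n::finite rpoly"
  assumes I: "finite I" and S: "\<And>i. i \<in> I \<Longrightarrow> finite (S i)"
    and zero: "(\<exists>i\<in>I. 0 \<in> S i) \<or> coeff f 0 = 0"
  shows "(INF y\<in>{y. psd_moments I S y \<and> y 0 = 1}. ereal (riesz y f)) =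
         (SUP \<gamma>\<in>{\<gamma>. f - Const \<gamma> \<in> gram_cone I S}. ereal \<gamma>)" (is "?inf = ?sup")
proof (rule antisym)
  show "?sup \<le> ?inf"
  proof (intro SUP_least INF_greatest)
    fix \<gamma> y
    assume "\<gamma> \<in> {\<gamma>. f - Const \<gamma> \<in> gram_cone I S}" "y \<in> {y. psd_moments I S y \<and> y 0 = 1}"
    then show "ereal \<gamma> \<le> ereal (riesz y f)"
      using riesz_gram_cone_nonneg[OF S, where I = I and p = "f - Const \<gamma>" and y = y]
      by (simp add: riesz_diff riesz_Const)
  qed
  have inf_le: "?inf \<le> ereal (riesz y f)" if "psd_moments I S y" "y 0 = 1" for y
    using that by (intro INF_lower) simp
  show "?inf \<le> ?sup"
  proof (rule ccontr)
    assume "\<not> ?inf \<le> ?sup"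
    \<comment> \<open>A duality gap would contain a real \<open>\<gamma>\<close> that no element of
      the cone certifies and that every feasible moment value exceeds.\<close>
    then obtain \<gamma> where \<gamma>: "?sup < ereal \<gamma>" "ereal \<gamma> < ?inf"
      using ereal_dense2[of ?sup ?inf] by (meson linorder_not_le)
    have sup_lower: "\<delta> < \<gamma>" if "f - Const \<delta> \<in> gram_cone I S" for \<delta>
    proof -
      have "ereal \<delta> \<le> ?sup" using that by (intro SUP_upper) simp
      from le_less_trans[OF this \<gamma>(1)] show ?thesis by simp
    qed
    have inf_gt: "\<gamma> < riesz y f" if "psd_moments I S y" "y 0 = 1" for y
      using less_le_trans[OF \<gamma>(2) inf_le[OF that]] by simp
    show False
    proof (cases "\<exists>i\<in>I. 0 \<in> S i")
      case True
      have "f - Const \<gamma> \<notin> gram_cone I S" using sup_lower[of \<gamma>] by auto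
      then obtain y where y: "psd_moments I S y" "riesz y (f - Const \<gamma>) < 0"
        by (rule gram_cone_separation[OF I, of S, rotated]) (use S in auto)
      have y0: "0 \<le> y 0" using True S psd_moments_zero_nonneg[OF y(1)] by auto
      \<comment> \<open>Since \<open>y 0\<close> may be 0, \<open>y\<close> cannot simply be
        normalised. The number \<open>coeff f 0 - \<gamma>\<close> is the value of
        \<open>dirac0\<close> at \<open>f - Const \<gamma>\<close>, and \<open>t\<close> is so large
        that adding \<open>t\<close> times \<open>y\<close> makes this value negative.\<close>
      obtain t where t: "0 \<le> t" "coeff f 0 - \<gamma> + t * riesz y (f - Const \<gamma>) < 0"
        using affine_below[OF y(2)] .
      define z where "z \<alpha> = inverse (1 + t * y 0) * (dirac0 \<alpha> + t * y \<alpha>)" for \<alpha>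
      have pos: "0 < 1 + t * y 0" using t(1) y0 by (simp add: add_pos_nonneg)
      have "psd_moments I S z"
        unfolding z_def using t(1) pos y(1)
        by (intro psd_moments_scale psd_moments_add psd_moments_dirac0) auto
      moreover have "z 0 = 1" using pos by (simp add: z_def dirac0_def)
      moreover have "riesz z f < \<gamma>"
      proof -
        have "riesz z f = (coeff f 0 + t * riesz y f) / (1 + t * y 0)"
          unfolding z_def riesz_scale_left riesz_add_left riesz_dirac0 by (simp add: field_simps)
        then show ?thesis
          using t(2) pos by (simp add: riesz_diff riesz_Const pos_divide_less_eq algebra_simps)
      qed
      ultimately show False using inf_gt[of z] by simp
    next
      case False
      then have f0: "coeff f 0 = 0" using zero by blast
      have "\<gamma> < 0"
        using inf_gt[OF psd_moments_dirac0] f0 by (simp add: riesz_dirac0 dirac0_def)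
      \<comment> \<open>Membership of \<open>f\<close> in the cone would certify the value 0, which
        lies above \<open>\<gamma>\<close>; so separation applies to \<open>f\<close>
        itself.\<close>
      then have "f \<notin> gram_cone I S" using sup_lower[of 0] by (auto simp: Const_def)
      then obtain y where y: "psd_moments I S y" "riesz y f < 0"
        by (rule gram_cone_separation[OF I, of S, rotated]) (use S in auto)
      obtain t where t: "0 \<le> t" "0 + t * riesz y f < \<gamma>"
        using affine_below[OF y(2)] .
      \<comment> \<open>No moment matrix has an entry at exponent 0 in this case and
        \<open>f\<close> has no constant term, so the value at 0 can be reset without changing
        anything else.\<close>
      define z where "z = (\<lambda>\<alpha>. t * y \<alpha>)(0 := 1)"
      have "psd_moments I S (\<lambda>\<alpha>. t * y \<alpha>)"
        using y(1) t(1) by (rule psd_moments_scale)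
      moreover have "moment_matrix z \<alpha> \<beta> = moment_matrix (\<lambda>\<alpha>. t * y \<alpha>) \<alpha> \<beta>"
        if "i \<in> I" "\<alpha> \<in> S i" for i \<alpha> \<beta>
      proof -
        have "\<alpha> + \<beta> \<noteq> 0" using that False by (auto simp: expo_add_eq_0_iff)
        then show ?thesis by (simp add: z_def moment_matrix_def)
      qed
      then have "psd_on (S i) (moment_matrix z) \<longleftrightarrow> psd_on (S i) (moment_matrix (\<lambda>\<alpha>. t * y \<alpha>))"
        if "i \<in> I" for i
        using that by (intro psd_on_cong) auto
      ultimately have "psd_moments I S z" by (simp add: psd_moments_def)
      moreover have "riesz z f = t * riesz y f"
        using f0 by (subst riesz_scale_left[symmetric], intro riesz_cong)
          (auto simp: z_def in_keys_iff)
      ultimately show False using inf_gt[of z] t(2) by (simp add: z_def)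
    qed
  qed
qed

section \<open>Comparison of the relaxations\<close>

text \<open>Each matrix is padded with zero rows and columns.\<close>

lemma gram_cone_mono:
  assumes "\<And>i. i \<in> I \<Longrightarrow> S i \<subseteq> T i" "\<And>i. i \<in> I \<Longrightarrow> finite (T i)"
  shows "gram_cone I S \<subseteq> gram_cone I T"
proof
  fix p assume "p \<in> gram_cone I S"
  then obtain W where W: "\<And>i. i \<in> I \<Longrightarrow> psd_on (S i) (W i)" "p = (\<Sum>i\<in>I. gram_poly (S i) (W i))"
    by (auto simp: gram_cone_def)
  define V where "V i \<alpha> \<beta> = (if \<alpha> \<in> S i \<and> \<beta> \<in> S i then W i \<alpha> \<beta> else 0)" for i \<alpha> \<beta>
  have ext: "(\<Sum>\<alpha>\<in>T i. \<Sum>\<beta>\<in>T i. h \<alpha> \<beta>) = (\<Sum>\<alpha>\<in>S i. \<Sum>\<beta>\<in>S i. h \<alpha> \<beta>)"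
    if "i \<in> I" "\<And>\<alpha> \<beta>. \<not> (\<alpha> \<in> S i \<and> \<beta> \<in> S i) \<Longrightarrow> h \<alpha> \<beta> = 0"
    for i and h :: "'b expo \<Rightarrow> 'b expo \<Rightarrow> 'c::comm_monoid_add"
  proof -
    have "(\<Sum>\<alpha>\<in>T i. \<Sum>\<beta>\<in>T i. h \<alpha> \<beta>) = (\<Sum>\<alpha>\<in>T i. \<Sum>\<beta>\<in>S i. h \<alpha> \<beta>)"
      using assms that by (intro sum.cong refl sum.mono_neutral_right) auto
    also have "\<dots> = (\<Sum>\<alpha>\<in>S i. \<Sum>\<beta>\<in>S i. h \<alpha> \<beta>)"
      using assms that by (intro sum.mono_neutral_right) auto
    finally show ?thesis .
  qed
  have "psd_on (T i) (V i)" if i: "i \<in> I" for i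
    unfolding psd_on_def
  proof (intro conjI ballI allI)
    show "V i \<alpha> \<beta> = V i \<beta> \<alpha>" for \<alpha> \<beta>
      using W(1)[OF i] by (auto simp: V_def psd_onD_sym)
    fix v
    have "(\<Sum>\<alpha>\<in>T i. \<Sum>\<beta>\<in>T i. v \<alpha> * V i \<alpha> \<beta> * v \<beta>) = (\<Sum>\<alpha>\<in>S i. \<Sum>\<beta>\<in>S i. v \<alpha> * V i \<alpha> \<beta> * v \<beta>)"
      using i by (intro ext) (auto simp: V_def)
    also have "\<dots> = (\<Sum>\<alpha>\<in>S i. \<Sum>\<beta>\<in>S i. v \<alpha> * W i \<alpha> \<beta> * v \<beta>)"
      by (simp add: V_def)
    finally show "0 \<le> (\<Sum>\<alpha>\<in>T i. \<Sum>\<beta>\<in>T i. v \<alpha> * V i \<alpha> \<beta> * v \<beta>)"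
      using psd_onD_nonneg[OF W(1)[OF i]] by simp
  qed
  moreover have "gram_poly (T i) (V i) = gram_poly (S i) (W i)" if i: "i \<in> I" for i
  proof -
    have "gram_poly (T i) (V i) = gram_poly (S i) (V i)"
      unfolding gram_poly_def using i by (intro ext) (auto simp: V_def Const_def)
    also have "\<dots> = gram_poly (S i) (W i)" by (intro gram_poly_cong) (simp add: V_def)
    finally show ?thesis .
  qed
  ultimately show "p \<in> gram_cone I T"
    unfolding gram_cone_def W(2) by (intro CollectI exI[of _ V]) auto
qed

section \<open>Sums of squares and pointwise nonnegativity\<close>

lemma is_sos_add: "is_sos p \<Longrightarrow> is_sos q \<Longrightarrow> is_sos (p + q)"
  unfolding is_sos_def by (metis map_append sum_list_append)

lemma is_sos_0: "is_sos 0"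
  unfolding is_sos_def by (metis list.map(1) sum_list.Nil)

lemma is_sos_sum: "(\<And>i. i \<in> I \<Longrightarrow> is_sos (p i)) \<Longrightarrow> is_sos (sum p I)"
  by (induction I rule: infinite_finite_induct) (simp_all add: is_sos_add is_sos_0)

lemma gram_poly_rank_one:
  "gram_poly S (\<lambda>\<alpha> \<beta>. w \<alpha> * w \<beta>) = (\<Sum>\<alpha>\<in>S. Poly_Mapping.single \<alpha> (w \<alpha>))\<^sup>2"
  by (simp add: gram_poly_alt power2_eq_square sum_product mult_single)

text \<open>Each rank-one term of the decomposition contributes one square.\<close>

lemma is_sos_gram_poly:
  assumes "finite S" "psd_on S W"
  shows "is_sos (gram_poly S W)"
proof -
  obtain ws :: "('a expo \<Rightarrow> real) list"
    where ws: "\<And>\<alpha> \<beta>. \<alpha> \<in> S \<Longrightarrow> \<beta> \<in> S \<Longrightarrow> W \<alpha> \<beta> = (\<Sum>w\<leftarrow>ws. w \<alpha> * w \<beta>)"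
    using psd_on_decomposition[OF assms] by blast
  have "gram_poly S W = gram_poly S (\<lambda>\<alpha> \<beta>. \<Sum>w\<leftarrow>ws. w \<alpha> * w \<beta>)"
    by (intro gram_poly_cong ws)
  also have "\<dots> = (\<Sum>w\<leftarrow>ws. gram_poly S (\<lambda>\<alpha> \<beta>. w \<alpha> * w \<beta>))"
    by (induction ws) (simp_all add: gram_poly_alt single_add sum.distrib)
  also have "\<dots> = (\<Sum>q\<leftarrow>map (\<lambda>w. \<Sum>\<alpha>\<in>S. Poly_Mapping.single \<alpha> (w \<alpha>)) ws. q\<^sup>2)"
    by (simp add: gram_poly_rank_one o_def)
  finally show ?thesis unfolding is_sos_def by blast
qed

lemma gram_cone_is_sos:
  assumes "\<And>i. i \<in> I \<Longrightarrow> finite (S i)" "p \<in> gram_cone I S"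
  shows "is_sos p"
  using assms by (auto simp: gram_cone_def intro!: is_sos_sum is_sos_gram_poly)

lemma eval_poly_eq_riesz: "eval_poly p x = riesz (\<lambda>\<alpha>. \<Prod>j\<in>UNIV. (x $ j) ^ (\<alpha> $ j)) p"
  by (simp add: eval_poly_def riesz_def)

lemma poly_eq_sum_single:
  fixes q :: "'n::finite rpoly"
  shows "q = (\<Sum>\<alpha>\<in>supp q. Poly_Mapping.single \<alpha> (coeff q \<alpha>))"
  by (intro poly_mapping_eqI) (auto simp: lookup_sum lookup_single when_def in_keys_iff)

text \<open>Point evaluation is the functional with multiplicative moments \<open>e\<close>, so it
  maps the rank-one Gram polynomial of \<open>q\<close> to a square of a real number.\<close>

lemma eval_poly_square_nonneg: "0 \<le> eval_poly (q\<^sup>2) x"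
proof -
  define e where "e \<alpha> = (\<Prod>j\<in>UNIV. (x $ j) ^ (\<alpha> $ j))" for \<alpha>
  have e: "e (\<alpha> + \<beta>) = e \<alpha> * e \<beta>" for \<alpha> \<beta>
    by (simp add: e_def power_add prod.distrib)
  have "eval_poly (q\<^sup>2) x = riesz e (gram_poly (supp q) (\<lambda>\<alpha> \<beta>. coeff q \<alpha> * coeff q \<beta>))"
    unfolding gram_poly_rank_one poly_eq_sum_single[symmetric] eval_poly_eq_riesz e_def ..
  also have "\<dots> = (\<Sum>\<alpha>\<in>supp q. coeff q \<alpha> * e \<alpha>)\<^sup>2"
    by (simp add: riesz_gram_poly e power2_eq_square sum_product mult_ac)
  finally show ?thesis by simp
qed

lemma is_sos_eval_nonneg:
  assumes "is_sos p"
  shows "0 \<le> eval_poly p x"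
proof -
  obtain qs where p: "p = (\<Sum>q\<leftarrow>qs. q\<^sup>2)" using assms by (auto simp: is_sos_def)
  have "eval_poly (\<Sum>q\<leftarrow>qs. q\<^sup>2) x = (\<Sum>q\<leftarrow>qs. eval_poly (q\<^sup>2) x)"
    by (induction qs) (simp_all add: eval_poly_eq_riesz riesz_add)
  then show ?thesis
    using eval_poly_square_nonneg by (auto simp: p intro!: sum_list_nonneg)
qed

lemma f_sos_le_f_min: "f_sos f \<le> f_min f"
  unfolding f_sos_def f_min_def
proof (intro SUP_least INF_greatest)
  fix \<gamma> x assume "\<gamma> \<in> {\<gamma>. is_sos (f - Const \<gamma>)}"
  then show "ereal \<gamma> \<le> ereal (eval_poly f x)"
    using is_sos_eval_nonneg[of "f - Const \<gamma>" x]
    by (simp add: eval_poly_eq_riesz riesz_diff riesz_Const)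
qed

section \<open>Exponent sets and half Newton polytopes\<close>

lemma finite_expos: "finite (expos \<Delta> k)"
proof (rule inj_on_finite)
  show "inj_on vec_nth (expos \<Delta> k)" by (auto simp: inj_on_def vec_eq_iff)
  show "vec_nth ` expos \<Delta> k \<subseteq> PiE UNIV (\<lambda>_. {..k})"
  proof clarify
    fix \<alpha> assume "\<alpha> \<in> expos \<Delta> k"
    then have "\<alpha> $ j \<le> k" for j
      using member_le_sum[of j UNIV "\<lambda>j. \<alpha> $ j"] by (auto simp: expos_def expo_deg_def)
    then show "vec_nth \<alpha> \<in> PiE UNIV (\<lambda>_. {..k})" by (simp add: PiE_iff)
  qed
  show "finite (PiE (UNIV :: 'a set) (\<lambda>_. {..k}))" by (intro finite_PiE) auto
qed

lemma expo_deg_le_total_deg: "\<alpha> \<in> supp p \<Longrightarrow> expo_deg \<alpha> \<le> total_deg p"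
  by (simp add: total_deg_def)

lemma supp_subset_expos:
  assumes "poly_in \<Delta> p" "total_deg p \<le> k"
  shows "supp p \<subseteq> expos \<Delta> k"
  using assms expo_deg_le_total_deg[of _ p] by (fastforce simp: poly_in_def expos_def)

text \<open>Support and degree bounds are linear conditions, so they pass from the generating points
  to the convex hull. The generators, being halves of exponents of degree at most
  \<open>2 * d\<close>, have degree at most \<open>d\<close>.\<close>

lemma half_newton_subset_expos:
  fixes p :: "'n::finite rpoly"
  assumes "poly_in \<Delta> p" "total_deg p \<le> 2 * d"
  shows "half_newton p \<subseteq> expos \<Delta> d"
proof
  fix \<alpha> assume \<alpha>: "\<alpha> \<in> half_newton p"
  define C where "C = {z :: real ^ 'n. (\<forall>j\<in>-\<Delta>. z $ j = 0) \<and> (\<Sum>j\<in>UNIV. z $ j) \<le> real d}"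
  have "convex C"
    unfolding convex_alt C_def
  proof (intro ballI allI impI CollectI conjI; clarsimp)
    fix u v :: "real ^ 'n" and t :: real
    assume "(\<Sum>j\<in>UNIV. u $ j) \<le> real d" "(\<Sum>j\<in>UNIV. v $ j) \<le> real d" "0 \<le> t" "t \<le> 1"
    then have "(1 - t) * (\<Sum>j\<in>UNIV. u $ j) + t * (\<Sum>j\<in>UNIV. v $ j) \<le> real d"
      by (intro convex_bound_le) auto
    then show "(\<Sum>j\<in>UNIV. (1 - t) * u $ j + t * v $ j) \<le> real d"
      by (simp add: sum.distrib sum_distrib_left)
  qed
  moreover have "real_expo ` {\<beta>. 2 *s \<beta> \<in> supp p} \<subseteq> C"
  proof clarify
    fix \<beta> assume "2 *s \<beta> \<in> supp p"
    then have *: "2 *s \<beta> \<in> expos \<Delta> (2 * d)"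
      using supp_subset_expos[OF assms] by blast
    then have "(\<Sum>j\<in>UNIV. \<beta> $ j) \<le> d" "\<forall>j\<in>-\<Delta>. \<beta> $ j = 0"
      by (auto simp: expos_def expo_deg_def expo_supp_def simp flip: sum_distrib_left)
    then show "real_expo \<beta> \<in> C"
      by (simp add: C_def real_expo_def flip: of_nat_sum)
  qed
  ultimately have "real_expo \<alpha> \<in> C"
    using \<alpha> hull_minimal[of _ C convex] by (auto simp: half_newton_def)
  then have "\<forall>j\<in>-\<Delta>. \<alpha> $ j = 0" "(\<Sum>j\<in>UNIV. \<alpha> $ j) \<le> d"
    by (auto simp: C_def real_expo_def simp flip: of_nat_sum)
  moreover from this(1) have "expo_supp \<alpha> \<subseteq> \<Delta>" unfolding expo_supp_def
    by (metis (mono_tags, lifting) ComplI mem_Collect_eq subsetI)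
  ultimately show "\<alpha> \<in> expos \<Delta> d" by (simp add: expos_def expo_deg_def)
qed

lemma zero_in_half_newton:
  assumes "coeff p 0 \<noteq> 0"
  shows "0 \<in> half_newton p"
proof -
  have "2 *s (0 :: 'a expo) = 0" by (simp add: vec_eq_iff)
  then have "real_expo 0 \<in> real_expo ` {\<beta>. 2 *s \<beta> \<in> supp p}"
    using assms by (intro imageI) (simp add: in_keys_iff)
  then show ?thesis by (simp add: half_newton_def hull_inc)
qed

theorem theorem3p15:
  fixes f :: "'n::finite rpoly"
    and fs :: "nat \<Rightarrow> 'n rpoly"
    and \<Delta> :: "nat \<Rightarrow> 'n set"
    and m d :: nat
    and ds :: "nat \<Rightarrow> nat"
  assumes "m \<ge> 1"
    and "f = (\<Sum>i=1..m. fs i)"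
    and "\<And>i. i \<in> {1..m} \<Longrightarrow> poly_in (\<Delta> i) (fs i)"
    and "\<And>i. i \<in> {1..m} \<Longrightarrow> total_deg (fs i) = 2 * ds i"
    and "total_deg f = 2 * d"
    and "2 * d = Max ((\<lambda>i. 2 * ds i) ` {1..m})"
  shows "f_Sigma_s m fs f = f_Delta_s m fs f \<and>
         f_Delta_s m fs f \<le> f_Sigma m \<Delta> d f \<and>
         f_Sigma m \<Delta> d f = f_Delta m \<Delta> d f \<and>
         f_Delta m \<Delta> d f \<le> f_sos f \<and>
         f_sos f \<le> f_min f"
proof -
  define G where "G i = half_newton (fs i)" for i
  define E where "E i = expos (\<Delta> i) d" for i
  have deg: "total_deg (fs i) \<le> 2 * d" if "i \<in> {1..m}" for i
    unfolding assms(4)[OF that] assms(6) using that by (intro Max_ge) auto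
  have finE: "finite (E i)" for i by (simp add: E_def finite_expos)
  have GE: "G i \<subseteq> E i" if "i \<in> {1..m}" for i
    unfolding G_def E_def using assms(3) deg that by (intro half_newton_subset_expos)
  have finG: "finite (G i)" if "i \<in> {1..m}" for i
    using finite_subset[OF GE finE] that .
  \<comment> \<open>All four relaxations are rewritten as instances of the generic conic pair, with
    families \<open>G\<close> and \<open>E\<close>. The moment objectives become
    \<open>riesz y f\<close> because their finite index sets contain \<open>supp f\<close>.\<close>
  have Delta_s: "f_Delta_s m fs f = (SUP \<gamma>\<in>{\<gamma>. f - Const \<gamma> \<in> gram_cone {1..m} G}. ereal \<gamma>)"
    by (simp add: f_Delta_s_def gram_cone_def G_def)
  have Delta: "f_Delta m \<Delta> d f = (SUP \<gamma>\<in>{\<gamma>. f - Const \<gamma> \<in> gram_cone {1..m} E}. ereal \<gamma>)"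
    by (simp add: f_Delta_def gram_cone_def E_def)
  have "sparser_index m fs f = {0} \<union> supp f \<union> (\<Union>i\<in>{1..m}. (\<lambda>(\<alpha>, \<beta>). \<alpha> + \<beta>) ` (G i \<times> G i))"
    by (auto simp: sparser_index_def G_def)
  then have "finite (sparser_index m fs f)" "supp f \<subseteq> sparser_index m fs f"
    using finG by auto
  then have Sigma_s: "f_Sigma_s m fs f =
      (INF y\<in>{y. psd_moments {1..m} G y \<and> y 0 = 1}. ereal (riesz y f))"
    by (simp add: f_Sigma_s_def psd_moments_def G_def riesz_superset)
  have "supp f \<subseteq> (\<Union>i\<in>{1..m}. supp (fs i))"
    unfolding assms(2) by (rule keys_sum)
  also have "\<dots> \<subseteq> moment_index m \<Delta> d"
    unfolding moment_index_def using assms(3) deg by (intro UN_mono order_refl supp_subset_expos)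
  finally have "supp f \<subseteq> moment_index m \<Delta> d" .
  then have Sigma: "f_Sigma m \<Delta> d f =
      (INF y\<in>{y. psd_moments {1..m} E y \<and> y 0 = 1}. ereal (riesz y f))"
    by (simp add: f_Sigma_def psd_moments_def E_def riesz_superset moment_index_def finite_expos)
  \<comment> \<open>A nonzero constant term of \<open>f\<close> must come from some
    \<open>fs i\<close>, whose half Newton polytope then contains 0. This is the side condition of
    the duality theorem.\<close>
  have "(\<exists>i\<in>{1..m}. 0 \<in> G i) \<or> coeff f 0 = 0"
    unfolding assms(2) lookup_sum G_def using zero_in_half_newton by (metis sum.neutral)
  then have eq_s: "f_Sigma_s m fs f = f_Delta_s m fs f"
    unfolding Sigma_s Delta_s by (intro gram_moment_duality finG) auto
  \<comment> \<open>In the sparse case the side condition holds outright, as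
    \<open>m \<ge> 1\<close> makes the index 1 available.\<close>
  have "0 \<in> E 1" by (simp add: E_def expos_def expo_supp_def expo_deg_def)
  then have eq: "f_Sigma m \<Delta> d f = f_Delta m \<Delta> d f"
    unfolding Sigma Delta using assms(1) by (intro gram_moment_duality finE) force+
  have "f_Delta_s m fs f \<le> f_Delta m \<Delta> d f"
    unfolding Delta_s Delta using gram_cone_mono[of "{1..m}" G E, OF GE finE]
    by (intro SUP_subset_mono) auto
  moreover have "f_Delta m \<Delta> d f \<le> f_sos f"
    unfolding Delta f_sos_def using gram_cone_is_sos[OF finE]
    by (intro SUP_subset_mono) auto
  ultimately show ?thesis using eq_s eq f_sos_le_f_min by simp
qed

end
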